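(* Let $A$ be a unital $C^*$-algebra. Then for every $a\in A$ the following statements hold: (i) $\sigma_{dsc}(L_{a^*})=\overline{\sigma_{dsc}(R_a)}$ and $\sigma_{dsc}(R_{a^*})=\overline{\sigma_{dsc}(L_a)}$; (ii) $\sigma_{\mathcal{RD}}(L_{a^*})=\overline{\sigma_{\mathcal{RD}}(R_a)}$ and $\sigma_{\mathcal{RD}}(R_{a^*})=\overline{\sigma_{\mathcal{RD}}(L_a)}$; (iii) $\sigma_{asc}(L_{a^*})=\overline{\sigma_{asc}(R_a)}$ and $\sigma_{asc}(R_{a^*})=\overline{\sigma_{asc}(L_a)}$; (iv) $\sigma_{\mathcal{LD}}(L_{a^*})=\overline{\sigma_{\mathcal{LD}}(R_a)}$ and $\sigma_{\mathcal{LD}}(R_{a^*})=\overline{\sigma_{\mathcal{LD}}(L_a)}$. Furthermore, when $a$ is hermitian ($a=a^*$), all the spectra appearing in (i)-(iv) are contained in the real line, and (v) $\sigma_{asc}(L_a)=\sigma_{asc}(R_a)$ and $\sigma_{\mathcal{LD}}(L_a)=\sigma_{\mathcal{LD}}(R_a)$; (vi) $\sigma_{\mathcal{DR}}(a)=\sigma_{dsc}(L_a)=\sigma_{dsc}(R_a)=\sigma_{\mathcal{RD}}(L_a)=\sigma_{\mathcal{RD}}(R_a)$.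
   Context: For $K\subseteq\mathbb C$, $\overline{K}=\{\overline{\alpha}:\alpha\in K\}$ denotes the set of complex conjugates (not the closure). For $a$ in a unital Banach algebra $A$ with unit $e$, $a-\lambda$ means $a-\lambda e$, and $L_a,R_a\colon A\to A$ are the bounded linear operators $L_a(x)=ax$, $R_a(x)=xa$. An element $a\in A$ is Drazin invertible if there exist $b\in A$ and $m\in\mathbb N$ such that $a^mba=a^m$, $bab=b$ and $ab=ba$; the Drazin spectrum is $\sigma_{\mathcal{DR}}(a)=\{\lambda\in\mathbb C: a-\lambda \text{ is not Drazin invertible in } A\}$. For a Banach space $X$ let $L(X)$ be the algebra of bounded linear operators on $X$. For $T\in L(X)$, with null space $N(T)$ and range $R(T)$, the descent and the ascent of $T$ are $d(T)=\inf\{n\ge 0: R(T^n)=R(T^{n+1})\}$ and $a(T)=\inf\{n\ge 0: N(T^n)=N(T^{n+1})\}$, with $\inf\emptyset=\infty$. Let $\mathcal{LD}(X)=\{T\in L(X): a(T)<\infty \text{ and } R(T^{a(T)+1}) \text{ is closed}\}$ and $\mathcal{RD}(X)=\{T\in L(X): d(T)<\infty \text{ and } R(T^{d(T)}) \text{ is closed}\}$. The left Drazin, right Drazin, descent and ascent spectra of $T$ are $\sigma_{\mathcal{LD}}(T)=\{\lambda\in\mathbb C: T-\lambda\notin\mathcal{LD}(X)\}$, $\sigma_{\mathcal{RD}}(T)=\{\lambda\in\mathbb C: T-\lambda\notin\mathcal{RD}(X)\}$, $\sigma_{dsc}(T)=\{\lambda\in\mathbb C: d(T-\lambda)=\infty\}$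 and $\sigma_{asc}(T)=\{\lambda\in\mathbb C: a(T-\lambda)=\infty\}$. These are applied with $X=A$ to the multiplication operators. *)

theory Defs
  imports "HOL-Analysis.Analysis" "HOL-Library.Extended_Nat"
begin

(* HOL-Analysis has only real normed spaces and algebras.  The classes below add a complex
   scalar multiplication extending the real one.  *)

class complex_normed_space = real_normed_vector +
  fixes scaleC :: "complex \<Rightarrow> 'a \<Rightarrow> 'a"  (infixr \<open>*\<^sub>C\<close> 75)
  assumes scaleC_add_right: "c *\<^sub>C (x + y) = c *\<^sub>C x + c *\<^sub>C y"
    and scaleC_add_left: "(c + d) *\<^sub>C x = c *\<^sub>C x + d *\<^sub>C x"
    and scaleC_scaleC: "c *\<^sub>C d *\<^sub>C x = (c * d) *\<^sub>C x"
    and scaleC_one: "1 *\<^sub>C x = x"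
    and scaleR_scaleC: "r *\<^sub>R x = complex_of_real r *\<^sub>C x"
    and norm_scaleC: "norm (c *\<^sub>C x) = cmod c * norm x"

class complex_banach = complex_normed_space + complete_space

(* As usual for unital algebras, A is nonzero (inherited from real_normed_algebra_1).  The
   normalisation norm 1 = 1, inherited from the same class, is automatic in a nonzero unital
   C*-algebra, by the C*-identity.  *)

class complex_banach_algebra_1 = complex_banach + real_normed_algebra_1 +
  assumes mult_scaleC_left: "(c *\<^sub>C x) * y = c *\<^sub>C (x * y)"
    and mult_scaleC_right: "x * (c *\<^sub>C y) = c *\<^sub>C (x * y)"

class cstar_algebra_1 = complex_banach_algebra_1 +
  fixes star :: "'a \<Rightarrow> 'a"
  assumes star_add: "star (x + y) = star x + star y"
    and star_scaleC: "star (c *\<^sub>C x) = cnj c *\<^sub>C star x"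
    and star_mult: "star (x * y) = star y * star x"
    and star_star: "star (star x) = x"
    and cstar_identity: "norm (star x * x) = (norm x)\<^sup>2"

instantiation complex :: cstar_algebra_1
begin

definition scaleC_complex :: "complex \<Rightarrow> complex \<Rightarrow> complex"
  where "scaleC_complex c x = c * x"

definition star_complex :: "complex \<Rightarrow> complex"
  where "star_complex = cnj"

instance
  by standard
    (simp_all add: scaleC_complex_def star_complex_def algebra_simps scaleR_conv_of_real
      norm_mult power2_eq_square)

end

definition bounded_operators :: "('a::complex_banach \<Rightarrow> 'a) set"
  where "bounded_operators = {T. bounded_linear T \<and> (\<forall>c x. T (c *\<^sub>C x) = c *\<^sub>C T x)}"

definition null_space :: "('a::complex_banach \<Rightarrow> 'a) \<Rightarrow> 'a set"
  where "null_space T = {x. T x = 0}"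

(* In enat, the infimum of the empty set is \<infinity>.  *)

definition descent :: "('a::complex_banach \<Rightarrow> 'a) \<Rightarrow> enat"
  where "descent T = Inf (enat ` {n. range (T ^^ n) = range (T ^^ (n + 1))})"

definition ascent :: "('a::complex_banach \<Rightarrow> 'a) \<Rightarrow> enat"
  where "ascent T = Inf (enat ` {n. null_space (T ^^ n) = null_space (T ^^ (n + 1))})"

definition left_drazin :: "('a::complex_banach \<Rightarrow> 'a) set"
  where "left_drazin = {T \<in> bounded_operators.
    ascent T < \<infinity> \<and> closed (range (T ^^ (the_enat (ascent T) + 1)))}"

definition right_drazin :: "('a::complex_banach \<Rightarrow> 'a) set"
  where "right_drazin = {T \<in> bounded_operators.
    descent T < \<infinity> \<and> closed (range (T ^^ the_enat (descent T)))}"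

definition shift :: "('a::complex_banach \<Rightarrow> 'a) \<Rightarrow> complex \<Rightarrow> 'a \<Rightarrow> 'a"
  where "shift T z = (\<lambda>x. T x - z *\<^sub>C x)"

definition LD_spectrum :: "('a::complex_banach \<Rightarrow> 'a) \<Rightarrow> complex set"
  where "LD_spectrum T = {z. shift T z \<notin> left_drazin}"

definition RD_spectrum :: "('a::complex_banach \<Rightarrow> 'a) \<Rightarrow> complex set"
  where "RD_spectrum T = {z. shift T z \<notin> right_drazin}"

definition dsc_spectrum :: "('a::complex_banach \<Rightarrow> 'a) \<Rightarrow> complex set"
  where "dsc_spectrum T = {z. descent (shift T z) = \<infinity>}"

definition asc_spectrum :: "('a::complex_banach \<Rightarrow> 'a) \<Rightarrow> complex set"
  where "asc_spectrum T = {z. ascent (shift T z) = \<infinity>}"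

definition drazin_invertible :: "'a::complex_banach_algebra_1 \<Rightarrow> bool"
  where "drazin_invertible a \<longleftrightarrow>
    (\<exists>b. \<exists>m::nat. a ^ m * b * a = a ^ m \<and> b * a * b = b \<and> a * b = b * a)"

definition drazin_spectrum :: "'a::complex_banach_algebra_1 \<Rightarrow> complex set"
  where "drazin_spectrum a = {z. \<not> drazin_invertible (a - z *\<^sub>C 1)}"

definition left_mult :: "'a::complex_banach_algebra_1 \<Rightarrow> 'a \<Rightarrow> 'a"
  where "left_mult a = (\<lambda>x. a * x)"

definition right_mult :: "'a::complex_banach_algebra_1 \<Rightarrow> 'a \<Rightarrow> 'a"
  where "right_mult a = (\<lambda>x. x * a)"

lemma left_mult_bounded: "left_mult a \<in> bounded_operators"
  by (simp add: bounded_operators_def left_mult_def bounded_linear_mult_right mult_scaleC_right)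

lemma right_mult_bounded: "right_mult a \<in> bounded_operators"
  by (simp add: bounded_operators_def right_mult_def bounded_linear_mult_left mult_scaleC_left)

end

theory Submission
  imports Defs
begin

text \<open>
  The involution \<open>star\<close> is a conjugate-linear isometry that reverses products, so
  \<open>left_mult (star b) = star \<circ> right_mult b \<circ> star\<close>.  Ranges and kernels of powers of conjugate
  operators correspond under \<open>star\<close>, and so do closed sets; hence \<open>left_mult (star b)\<close> and
  \<open>right_mult b\<close> have the same descent and ascent and are left or right Drazin simultaneously.
  Since \<open>shift (left_mult a) z = left_mult (a - z)\<close>, likewise on the right, and
  \<open>star (a - z) = star a - cnj z\<close>, this gives every equality between a spectrum of \<open>star a\<close> and a
  conjugated spectrum of \<open>a\<close>.

  Let \<open>a\<close> be hermitian.  For non-real \<open>z\<close> the element \<open>a - z\<close> is invertible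
  (\<open>hermitian_minus_nonreal_invertible\<close>): the C*-identity gives
  \<open>(norm (a + \<i>t))\<^sup>2 \<le> (norm a)\<^sup>2 + t\<^sup>2\<close> for real \<open>t\<close>, which for a suitable \<open>t\<close> is smaller than
  \<open>(cmod (z + \<i>t))\<^sup>2\<close>, and a Neumann series inverts \<open>(a + \<i>t) - (z + \<i>t)\<close>.  So all the spectra are
  real, conjugation fixes them, and the left and the right spectra coincide.

  It remains to compare the Drazin spectrum with the descent and right Drazin spectra at real \<open>z\<close>,
  where \<open>b = a - z\<close> is again hermitian.  The C*-identity shows that \<open>b\<^sup>2 x = 0\<close> implies \<open>b x = 0\<close>.
  If the descent of \<open>left_mult b\<close> is finite, then \<open>b\<^sup>n = b\<^sup>n b c\<close> for some \<open>n\<close> and \<open>c\<close>, and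
  cancelling powers of \<open>b\<close> yields \<open>b = b\<^sup>2 c\<close>; the adjoint equation is \<open>b = star c b\<^sup>2\<close>.  Together
  they provide a group inverse of \<open>b\<close>, which is a Drazin inverse, and an idempotent whose range is
  the range of \<open>left_mult b\<close>, which is therefore closed (\<open>hermitian_finite_descent\<close>).  Conversely,
  Drazin invertibility always makes the descent finite (\<open>drazin_invertible_finite_descent\<close>).
\<close>

section \<open>Descent and ascent\<close>

lemma descent_finite_iff:
  "descent T < \<infinity> \<longleftrightarrow> (\<exists>n. range (T ^^ n) = range (T ^^ (n + 1)))"
proof -
  let ?S = "{n. range (T ^^ n) = range (T ^^ (n + 1))}"
  have "descent T < \<infinity> \<longleftrightarrow> ?S \<noteq> {}"
  proof
    assume finite: "descent T < \<infinity>"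
    show "?S \<noteq> {}"
    proof
      assume "?S = {}"
      then have "descent T = Inf {}"
        unfolding descent_def by (simp only: image_empty)
      then show False
        using finite by (simp add: Inf_enat_def)
    qed
  next
    assume "?S \<noteq> {}"
    then obtain n where "n \<in> ?S"
      by blast
    then have "descent T \<le> enat n"
      unfolding descent_def by (intro Inf_lower imageI)
    also have "\<dots> < \<infinity>"
      by simp
    finally show "descent T < \<infinity>" .
  qed
  then show ?thesis
    by blast
qed

lemma descent_surj:
  assumes "surj T"
  shows "descent T = 0"
proof -
  have "descent T \<le> enat 0"
    unfolding descent_def by (rule Inf_lower) (use assms in auto)
  then show ?thesis
    by (simp add: zero_enat_def[symmetric])
qed

lemma ascent_trivial_null_space:
  assumes "null_space T = {0}"
  shows "ascent T = 0"
proof -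
  have "ascent T \<le> enat 0"
    unfolding ascent_def by (rule Inf_lower) (use assms in \<open>auto simp: null_space_def\<close>)
  then show ?thesis
    by (simp add: zero_enat_def[symmetric])
qed

lemma the_enat_0: "the_enat 0 = 0"
  unfolding zero_enat_def by (rule the_enat.simps)

lemma right_drazin_surj:
  assumes "T \<in> bounded_operators" "surj T"
  shows "T \<in> right_drazin"
  using assms by (auto simp: right_drazin_def descent_surj the_enat_0 zero_enat_def[symmetric]
      intro!: exI[of _ 0])

lemma left_drazin_bij:
  assumes "T \<in> bounded_operators" "surj T" "null_space T = {0}"
  shows "T \<in> left_drazin"
  using assms by (auto simp: left_drazin_def ascent_trivial_null_space the_enat_0 zero_enat_def[symmetric]
      intro!: exI[of _ 0])


section \<open>Conjugation by an involution\<close>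

lemma funpow_conjugate:
  assumes "\<And>x. J (J x) = x"
  shows "(J \<circ> S \<circ> J) ^^ n = J \<circ> (S ^^ n) \<circ> J"
  by (induction n) (simp_all add: fun_eq_iff assms)

lemma range_conjugate:
  assumes "\<And>x. J (J x) = x"
  shows "range ((J \<circ> S \<circ> J) ^^ n) = J ` range (S ^^ n)"
proof -
  have "surj J"
    using assms by (metis surjI)
  then show ?thesis
    by (metis funpow_conjugate[of J, OF assms] image_comp)
qed

lemma null_space_conjugate:
  assumes "\<And>x. J (J x) = x" "J 0 = 0"
  shows "null_space ((J \<circ> S \<circ> J) ^^ n) = J -` null_space (S ^^ n)"
  unfolding funpow_conjugate[of J, OF assms(1)] null_space_def
  using assms by (auto simp: fun_eq_iff) (metis assms)

lemma descent_conjugate: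
  assumes "\<And>x. J (J x) = x"
  shows "descent (J \<circ> S \<circ> J) = descent S"
proof -
  have "inj J"
    using assms by (metis injI)
  then show ?thesis
    by (simp only: descent_def range_conjugate[of J, OF assms] inj_image_eq_iff)
qed

lemma ascent_conjugate:
  assumes "\<And>x. J (J x) = x" "J 0 = 0"
  shows "ascent (J \<circ> S \<circ> J) = ascent S"
proof -
  have "surj J"
    using assms by (metis surjI)
  then have "J -` M = J -` N \<longleftrightarrow> M = N" for M N
    by (metis surj_image_vimage_eq)
  then show ?thesis
    by (simp only: ascent_def null_space_conjugate[of J, OF assms])
qed

text \<open>The image under an involution is also the preimage, so continuity makes it closed.\<close>

lemma closed_range_conjugate:
  fixes J :: "'a::complex_banach \<Rightarrow> 'a"
  assumes "\<And>x. J (J x) = x" "continuous_on UNIV J"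
  shows "closed (range ((J \<circ> S \<circ> J) ^^ n)) \<longleftrightarrow> closed (range (S ^^ n))"
proof -
  have "J ` M = J -` M" for M
    using assms(1) by (auto simp: image_iff) (metis assms(1))
  moreover have "J -` (J -` M) = M" for M
    using assms(1) by auto
  ultimately show ?thesis
    unfolding range_conjugate[of J, OF assms(1)]
    by (metis assms(2) closed_vimage)
qed


section \<open>Multiplication operators\<close>

lemma scaleC_minus_left: "(- c) *\<^sub>C x = - (c *\<^sub>C x)" for x :: "'a::complex_normed_space"
  by (metis add.right_inverse add_diff_cancel_left' diff_0 norm_eq_zero norm_scaleC norm_zero
      mult_zero_left scaleC_add_left)

lemma shift_left_mult: "shift (left_mult a) z = left_mult (a - z *\<^sub>C 1)"
  by (simp add: shift_def left_mult_def fun_eq_iff left_diff_distrib mult_scaleC_left)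

lemma shift_right_mult: "shift (right_mult a) z = right_mult (a - z *\<^sub>C 1)"
  by (simp add: shift_def right_mult_def fun_eq_iff right_diff_distrib mult_scaleC_right)

lemma funpow_left_mult: "left_mult a ^^ n = left_mult (a ^ n)"
  by (induction n) (simp_all add: left_mult_def fun_eq_iff mult.assoc)

lemma invertible_mult_operators:
  fixes b :: "'a::complex_banach_algebra_1"
  assumes "b * u = 1" "u * b = 1" "T \<in> {left_mult b, right_mult b}"
  shows "descent T < \<infinity>" "ascent T < \<infinity>" "T \<in> right_drazin" "T \<in> left_drazin"
proof -
  have bounded: "T \<in> bounded_operators"
    using assms(3) left_mult_bounded right_mult_bounded by blast
  have cancel: "b * (u * x) = x" "u * (b * x) = x" "(x * u) * b = x" "(x * b) * u = x" for x
    by (metis assms(1,2) mult.assoc mult_1_left mult_1_right)+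
  have surj: "surj T"
    using assms(3) cancel unfolding left_mult_def right_mult_def surj_def by (metis insertE singletonD)
  have null: "null_space T = {0}"
    using assms(3) cancel
    by (auto simp: left_mult_def right_mult_def null_space_def) (metis mult_zero_left mult_zero_right)+
  show "descent T < \<infinity>" "ascent T < \<infinity>" "T \<in> right_drazin" "T \<in> left_drazin"
    using descent_surj[OF surj] ascent_trivial_null_space[OF null]
      right_drazin_surj[OF bounded surj] left_drazin_bij[OF bounded surj null] by simp_all
qed

lemma drazin_invertible_finite_descent:
  assumes "drazin_invertible b"
  shows "descent (left_mult b) < \<infinity>"
proof -
  obtain c m where c: "b ^ m * c * b = b ^ m" "b * c = c * b"
    using assms unfolding drazin_invertible_def by blast
  have "b ^ m * x = b ^ Suc m * (c * x)" for x
    by (metis c mult.assoc power_Suc2)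
  moreover have "b ^ Suc m * x = b ^ m * (b * x)" for x
    by (metis mult.assoc power_Suc2)
  ultimately have "range (left_mult b ^^ m) = range (left_mult b ^^ (m + 1))"
    unfolding funpow_left_mult unfolding left_mult_def Suc_eq_plus1[symmetric]
    by (metis (no_types, lifting) image_subset_iff rangeI subset_antisym)
  then show ?thesis
    using descent_finite_iff by blast
qed


section \<open>The Neumann series\<close>

subclass (in complex_banach) banach ..

lemma one_minus_invertible:
  fixes x :: "'a::complex_banach_algebra_1"
  assumes "norm x < 1"
  shows "\<exists>u. (1 - x) * u = 1 \<and> u * (1 - x) = 1"
proof -
  have "summable (\<lambda>n. norm (x ^ n))"
    by (rule summable_comparison_test'[OF summable_geometric[of "norm x"]])
      (use assms in \<open>auto simp: norm_power_ineq\<close>)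
  then have sum: "summable (\<lambda>n. x ^ n)"
    by (rule summable_norm_cancel)
  define s where "s = (\<Sum>n. x ^ n)"
  have "(\<Sum>n. x ^ Suc n) = s - 1"
    using suminf_split_head[OF sum] by (simp add: s_def)
  moreover have "(\<Sum>n. x ^ Suc n) = x * s"
    using suminf_mult[OF sum, of x] by (simp add: s_def)
  moreover have "(\<Sum>n. x ^ Suc n) = s * x"
    using suminf_mult2[OF sum, of x] by (simp add: s_def power_commutes)
  ultimately show ?thesis
    by (intro exI[of _ s]) (simp add: algebra_simps)
qed

lemma minus_scaleC_invertible:
  fixes b :: "'a::complex_banach_algebra_1"
  assumes "norm b < cmod w"
  shows "\<exists>u. (b - w *\<^sub>C 1) * u = 1 \<and> u * (b - w *\<^sub>C 1) = 1"
proof -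
  have w: "w \<noteq> 0"
    using assms by auto
  have "norm (inverse w *\<^sub>C b) < 1"
    using assms w by (simp add: norm_scaleC norm_inverse flip: divide_inverse_commute)
  then obtain u where u: "(1 - inverse w *\<^sub>C b) * u = 1" "u * (1 - inverse w *\<^sub>C b) = 1"
    using one_minus_invertible by blast
  have scale: "x - inverse w *\<^sub>C y = - (inverse w *\<^sub>C (y - w *\<^sub>C x))" for x y :: 'a
    using w scaleC_add_right[of "inverse w" "y - w *\<^sub>C x" "w *\<^sub>C x"]
    by (simp add: scaleC_scaleC scaleC_one)
  have "(b - w *\<^sub>C 1) * (- (inverse w *\<^sub>C u)) = 1" "- (inverse w *\<^sub>C u) * (b - w *\<^sub>C 1) = 1"
    using u unfolding scale by (simp_all add: mult_scaleC_left mult_scaleC_right)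
  then show ?thesis
    by blast
qed


section \<open>The involution\<close>

text \<open>
  The C*-identity and submultiplicativity give \<open>norm x \<le> norm (star x)\<close>; applying this to \<open>star x\<close>
  gives the reverse inequality.
\<close>

lemma norm_star: "norm (star x) = norm x" for x :: "'a::cstar_algebra_1"
proof -
  have le: "norm y \<le> norm (star y)" for y :: 'a
  proof (cases "y = 0")
    case False
    have "norm y * norm y \<le> norm (star y) * norm y"
      using norm_mult_ineq[of "star y" y] by (simp add: cstar_identity power2_eq_square)
    then show ?thesis
      using False by simp
  qed simp
  show ?thesis
    using le[of x] le[of "star x"] by (simp add: star_star)
qed

lemma bounded_linear_star: "bounded_linear (star :: 'a::cstar_algebra_1 \<Rightarrow> 'a)"
  by (rule bounded_linear_intro[where K = 1])
    (simp_all add: star_add star_scaleC scaleR_scaleC norm_star)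

lemmas star_diff = linear_diff[OF bounded_linear.linear[OF bounded_linear_star]]
lemmas star_zero = linear_0[OF bounded_linear.linear[OF bounded_linear_star]]

lemma star_one: "star 1 = (1 :: 'a::cstar_algebra_1)"
  by (metis mult.left_neutral mult.right_neutral star_mult star_star)

lemma star_minus_scaleC_one: "star (a - z *\<^sub>C 1) = star a - cnj z *\<^sub>C 1"
  by (simp add: star_diff star_scaleC star_one)

lemma left_mult_star: "left_mult (star b) = star \<circ> right_mult b \<circ> star"
  by (simp add: fun_eq_iff left_mult_def right_mult_def star_mult star_star)

lemma right_mult_star: "right_mult (star b) = star \<circ> left_mult b \<circ> star"
  by (simp add: fun_eq_iff left_mult_def right_mult_def star_mult star_star)

lemma continuous_star: "continuous_on UNIV (star :: 'a::cstar_algebra_1 \<Rightarrow> 'a)"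
  by (rule bounded_linear.continuous_on[OF bounded_linear_star continuous_on_id])

lemmas conjugate_star =
  descent_conjugate[of star, OF star_star]
  ascent_conjugate[of star, OF star_star star_zero]
  closed_range_conjugate[of star, OF star_star continuous_star]

lemma descent_mult_star:
  "descent (left_mult (star b)) = descent (right_mult b)"
  "descent (right_mult (star b)) = descent (left_mult b)"
  by (simp_all only: left_mult_star right_mult_star conjugate_star)

lemma ascent_mult_star:
  "ascent (left_mult (star b)) = ascent (right_mult b)"
  "ascent (right_mult (star b)) = ascent (left_mult b)"
  by (simp_all only: left_mult_star right_mult_star conjugate_star)

lemma right_drazin_mult_star:
  "left_mult (star b) \<in> right_drazin \<longleftrightarrow> right_mult b \<in> right_drazin"
  "right_mult (star b) \<in> right_drazin \<longleftrightarrow> left_mult b \<in> right_drazin"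
  by (simp_all only: right_drazin_def mem_Collect_eq left_mult_bounded right_mult_bounded)
    (simp_all only: left_mult_star right_mult_star conjugate_star)

lemma left_drazin_mult_star:
  "left_mult (star b) \<in> left_drazin \<longleftrightarrow> right_mult b \<in> left_drazin"
  "right_mult (star b) \<in> left_drazin \<longleftrightarrow> left_mult b \<in> left_drazin"
  by (simp_all only: left_drazin_def mem_Collect_eq left_mult_bounded right_mult_bounded)
    (simp_all only: left_mult_star right_mult_star conjugate_star)

lemma mem_cnj_image: "z \<in> cnj ` K \<longleftrightarrow> cnj z \<in> K"
  by (metis complex_cnj_cnj image_iff)

lemma cnj_image_real:
  assumes "K \<subseteq> \<real>"
  shows "cnj ` K = K"
  using assms by (simp add: set_eq_iff mem_cnj_image) (metis Reals_cnj_iff complex_cnj_cnj subsetD)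

lemma spectra_star:
  fixes a :: "'a::cstar_algebra_1"
  shows "dsc_spectrum (left_mult (star a)) = cnj ` dsc_spectrum (right_mult a)"
    and "dsc_spectrum (right_mult (star a)) = cnj ` dsc_spectrum (left_mult a)"
    and "RD_spectrum (left_mult (star a)) = cnj ` RD_spectrum (right_mult a)"
    and "RD_spectrum (right_mult (star a)) = cnj ` RD_spectrum (left_mult a)"
    and "asc_spectrum (left_mult (star a)) = cnj ` asc_spectrum (right_mult a)"
    and "asc_spectrum (right_mult (star a)) = cnj ` asc_spectrum (left_mult a)"
    and "LD_spectrum (left_mult (star a)) = cnj ` LD_spectrum (right_mult a)"
    and "LD_spectrum (right_mult (star a)) = cnj ` LD_spectrum (left_mult a)"
proof -
  have *: "star a - z *\<^sub>C 1 = star (a - cnj z *\<^sub>C 1)" for z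
    by (simp add: star_minus_scaleC_one)
  show "dsc_spectrum (left_mult (star a)) = cnj ` dsc_spectrum (right_mult a)"
    and "dsc_spectrum (right_mult (star a)) = cnj ` dsc_spectrum (left_mult a)"
    and "RD_spectrum (left_mult (star a)) = cnj ` RD_spectrum (right_mult a)"
    and "RD_spectrum (right_mult (star a)) = cnj ` RD_spectrum (left_mult a)"
    and "asc_spectrum (left_mult (star a)) = cnj ` asc_spectrum (right_mult a)"
    and "asc_spectrum (right_mult (star a)) = cnj ` asc_spectrum (left_mult a)"
    and "LD_spectrum (left_mult (star a)) = cnj ` LD_spectrum (right_mult a)"
    and "LD_spectrum (right_mult (star a)) = cnj ` LD_spectrum (left_mult a)"
    by (simp_all add: set_eq_iff mem_cnj_image dsc_spectrum_def RD_spectrum_def asc_spectrum_def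
        LD_spectrum_def shift_left_mult shift_right_mult * descent_mult_star ascent_mult_star
        right_drazin_mult_star left_drazin_mult_star)
qed


section \<open>Hermitian elements\<close>

text \<open>
  A trick of Arens: adding the same imaginary number to \<open>a\<close> and to \<open>z\<close> does not change \<open>a - z\<close>,
  and if it is large enough and on the side of \<open>Im z\<close>, then the modulus of the scalar exceeds the
  norm of the element.
\<close>

lemma hermitian_minus_nonreal_invertible:
  fixes a :: "'a::cstar_algebra_1"
  assumes "star a = a" "z \<notin> \<real>"
  shows "\<exists>u. (a - z *\<^sub>C 1) * u = 1 \<and> u * (a - z *\<^sub>C 1) = 1"
proof -
  have y: "Im z \<noteq> 0"
    using assms(2) complex_is_Real_iff by blast
  \<comment> \<open>This is chosen so that \<open>(Im z + t)\<^sup>2 - t\<^sup>2\<close> is \<open>(norm a)\<^sup>2 + (Im z)\<^sup>2\<close>.\<close>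
  define t where "t = (norm a)\<^sup>2 / (2 * Im z)"
  define b where "b = a + (\<i> * t) *\<^sub>C 1"
  define w where "w = z + \<i> * t"
  have "star b = a - (\<i> * t) *\<^sub>C 1"
    using scaleC_minus_left[of "\<i> * t" "1 :: 'a"]
    by (simp add: b_def star_add star_scaleC star_one assms(1))
  then have "star b * b = (a - (\<i> * t) *\<^sub>C 1) * (a + (\<i> * t) *\<^sub>C 1)"
    by (simp add: b_def)
  also have "\<dots> = a * a - (\<i> * t) *\<^sub>C (\<i> * t) *\<^sub>C 1"
    using scaleC_add_right[of "\<i> * t" "a - (\<i> * t) *\<^sub>C 1" "(\<i> * t) *\<^sub>C 1"]
    by (simp add: distrib_left left_diff_distrib mult_scaleC_left mult_scaleC_right)
  also have "\<dots> = a * a + of_real (t\<^sup>2) *\<^sub>C 1"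
    using scaleC_minus_left[of "of_real (t\<^sup>2)" "1 :: 'a"]
    by (simp add: scaleC_scaleC power2_eq_square algebra_simps)
  finally have "(norm b)\<^sup>2 \<le> norm (a * a) + norm (of_real (t\<^sup>2) *\<^sub>C (1 :: 'a))"
    by (metis cstar_identity norm_triangle_ineq)
  also have "\<dots> \<le> (norm a)\<^sup>2 + t\<^sup>2"
    using norm_mult_ineq[of a a] by (simp add: norm_scaleC power2_eq_square norm_mult)
  also have "\<dots> < (Re z)\<^sup>2 + (Im z + t)\<^sup>2"
  proof -
    have "(Im z + t)\<^sup>2 = (Im z)\<^sup>2 + 2 * Im z * t + t\<^sup>2"
      by (simp add: power2_eq_square algebra_simps)
    also have "2 * Im z * t = (norm a)\<^sup>2"
      using y by (simp add: t_def)
    finally show ?thesis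
      using y by (smt (verit) zero_less_power2 zero_le_power2)
  qed
  also have "\<dots> = (cmod w)\<^sup>2"
    by (simp add: w_def cmod_power2)
  finally have "norm b < cmod w"
    by (simp add: power_less_imp_less_base)
  moreover have "b - w *\<^sub>C 1 = a - z *\<^sub>C 1"
    by (simp add: b_def w_def scaleC_add_left)
  ultimately show ?thesis
    using minus_scaleC_invertible[of b w] by simp
qed

text \<open>
  For hermitian \<open>b\<close> the C*-identity for \<open>b y\<close> reads \<open>norm (b y)\<^sup>2 = norm (star y b\<^sup>2 y)\<close>, so \<open>b\<^sup>2 y = 0\<close> implies
  \<open>b y = 0\<close>.  With \<open>y\<close> a lower power of \<open>b\<close> times \<open>x\<close>, this removes the factors one by one.
\<close>

lemma hermitian_power_mult_eq_zero:
  fixes b :: "'a::cstar_algebra_1"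
  assumes "star b = b" "b ^ n * x = 0"
  shows "b * x = 0"
  using assms(2)
proof (induction n)
  case 0
  then show ?case by simp
next
  case (Suc n)
  show ?case
  proof (cases n)
    case 0
    then show ?thesis using Suc.prems by simp
  next
    case (Suc k)
    let ?y = "b ^ k * x"
    have "star (b * ?y) * (b * ?y) = star ?y * (b ^ Suc n * x)"
      by (simp add: star_mult assms(1) mult.assoc Suc)
    then have "(norm (b * ?y))\<^sup>2 = 0"
      using cstar_identity[of "b * ?y"] Suc.prems by simp
    then show ?thesis
      using Suc.IH by (simp add: Suc mult.assoc)
  qed
qed

text \<open>
  Cancelling powers turns finite descent into \<open>b = b\<^sup>2 c\<close>.  With the adjoint equation
  \<open>b = star c b\<^sup>2\<close> the element \<open>e = b c = star c b\<close> is a two-sided unit for \<open>b\<close>; then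
  \<open>star c b c\<close> is a group inverse of \<open>b\<close>, and \<open>b A = e A\<close> is the closed set of fixed points of
  \<open>left_mult e\<close>.
\<close>

lemma hermitian_finite_descent:
  fixes b :: "'a::cstar_algebra_1"
  assumes herm: "star b = b" and descent: "descent (left_mult b) < \<infinity>"
  shows "drazin_invertible b" "left_mult b \<in> right_drazin"
proof -
  obtain n where "range (left_mult b ^^ n) = range (left_mult b ^^ (n + 1))"
    using descent descent_finite_iff by blast
  then have "b ^ n * 1 \<in> range (\<lambda>x. b ^ Suc n * x)"
    unfolding funpow_left_mult unfolding left_mult_def by (metis Suc_eq_plus1 rangeI)
  then obtain c where "b ^ n = b ^ Suc n * c"
    by auto
  then have "b ^ n * (1 - b * c) = 0"
    by (simp only: power_Suc2) (simp add: right_diff_distrib mult.assoc)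
  then have "b * (1 - b * c) = 0"
    by (rule hermitian_power_mult_eq_zero[OF herm])
  then have c: "b * (b * c) = b"
    by (simp add: algebra_simps)
  define d where "d = star c"
  have d: "(d * b) * b = b"
    using arg_cong[OF c, of star] by (simp add: star_mult herm d_def)
  have e: "b * c = d * b"
    by (metis c d mult.assoc)
  have eb: "b * c * b = b"
    using d e by simp
  define g where "g = d * b * c"
  have bg: "b * g = b * c" and gb: "g * b = b * c"
    unfolding g_def by (metis c d e mult.assoc)+
  have "b ^ 1 * g * b = b ^ 1"
    using bg eb by simp
  moreover have "g * b * g = g"
    unfolding gb unfolding g_def by (metis e eb mult.assoc)
  ultimately show "drazin_invertible b"
    unfolding drazin_invertible_def using bg gb by metis

  have "range (left_mult b) = {x. b * c * x = x}"
  proof (intro equalityI subsetI)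
    fix x assume "x \<in> range (left_mult b)"
    then show "x \<in> {x. b * c * x = x}"
      using eb by (auto simp: left_mult_def) (metis mult.assoc)
  next
    fix x assume "x \<in> {x. b * c * x = x}"
    then have "x = left_mult b (c * x)"
      by (simp add: left_mult_def mult.assoc)
    then show "x \<in> range (left_mult b)"
      by blast
  qed
  then have closed_range: "closed (range (left_mult b))"
    by (simp add: closed_Collect_eq continuous_intros)
  \<comment> \<open>The descent is at most 1, so only the ranges of the identity and of \<open>left_mult b\<close> matter.\<close>
  have "b * x = b ^ 2 * (c * x)" and "b ^ 2 * x = b * (b * x)" for x
    by (metis c mult.assoc power2_eq_square)+
  then have "range (left_mult b ^^ 1) = range (left_mult b ^^ (1 + 1))"
    unfolding funpow_left_mult unfolding left_mult_def one_add_one power_one_right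
    by (metis (no_types, lifting) image_subset_iff rangeI subset_antisym)
  then have "descent (left_mult b) \<le> enat 1"
    unfolding descent_def by (intro Inf_lower) auto
  then have "the_enat (descent (left_mult b)) \<le> 1"
    using descent by (cases "descent (left_mult b)") auto
  then have "the_enat (descent (left_mult b)) \<in> {0, 1}"
    by auto
  then have "closed (range (left_mult b ^^ the_enat (descent (left_mult b))))"
    using closed_range by auto
  then show "left_mult b \<in> right_drazin"
    using descent by (simp add: right_drazin_def left_mult_bounded)
qed

lemma hermitian_spectra_real:
  fixes a :: "'a::cstar_algebra_1"
  assumes "star a = a" "T \<in> {left_mult a, right_mult a}"
  shows "dsc_spectrum T \<subseteq> \<real>" "RD_spectrum T \<subseteq> \<real>" "asc_spectrum T \<subseteq> \<real>" "LD_spectrum T \<subseteq> \<real>"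
proof -
  have "descent (shift T z) < \<infinity> \<and> ascent (shift T z) < \<infinity>
      \<and> shift T z \<in> right_drazin \<and> shift T z \<in> left_drazin" if nonreal: "z \<notin> \<real>" for z
  proof -
    obtain u where u: "(a - z *\<^sub>C 1) * u = 1" "u * (a - z *\<^sub>C 1) = 1"
      using hermitian_minus_nonreal_invertible[OF assms(1) nonreal] by blast
    have T: "shift T z \<in> {left_mult (a - z *\<^sub>C 1), right_mult (a - z *\<^sub>C 1)}"
      using assms(2) by (auto simp: shift_left_mult shift_right_mult)
    show ?thesis
      by (intro conjI invertible_mult_operators[OF u T])
  qed
  then show "dsc_spectrum T \<subseteq> \<real>" "RD_spectrum T \<subseteq> \<real>" "asc_spectrum T \<subseteq> \<real>" "LD_spectrum T \<subseteq> \<real>"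
    unfolding dsc_spectrum_def RD_spectrum_def asc_spectrum_def LD_spectrum_def
    by (metis (mono_tags, lifting) less_irrefl mem_Collect_eq subsetI)+
qed

lemma hermitian_drazin_spectrum:
  fixes a :: "'a::cstar_algebra_1"
  assumes "star a = a"
  shows "drazin_spectrum a = dsc_spectrum (left_mult a)"
    and "RD_spectrum (left_mult a) = dsc_spectrum (left_mult a)"
proof -
  have "(drazin_invertible (a - z *\<^sub>C 1) \<longleftrightarrow> descent (left_mult (a - z *\<^sub>C 1)) < \<infinity>)
      \<and> (left_mult (a - z *\<^sub>C 1) \<in> right_drazin \<longleftrightarrow> descent (left_mult (a - z *\<^sub>C 1)) < \<infinity>)" for z
  proof (cases "z \<in> \<real>")
    case True
    then have "star (a - z *\<^sub>C 1) = a - z *\<^sub>C 1"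
      by (simp add: star_minus_scaleC_one assms Reals_cnj_iff)
    then show ?thesis
      using hermitian_finite_descent drazin_invertible_finite_descent
      unfolding right_drazin_def by blast
  next
    case False
    then obtain u where u: "(a - z *\<^sub>C 1) * u = 1" "u * (a - z *\<^sub>C 1) = 1"
      using hermitian_minus_nonreal_invertible[OF assms] by blast
    then have "drazin_invertible (a - z *\<^sub>C 1)"
      unfolding drazin_invertible_def by (intro exI[of _ u] exI[of _ 0]) simp
    then show ?thesis
      using invertible_mult_operators[OF u insertI1] by simp
  qed
  then show "drazin_spectrum a = dsc_spectrum (left_mult a)"
    and "RD_spectrum (left_mult a) = dsc_spectrum (left_mult a)"
    unfolding drazin_spectrum_def dsc_spectrum_def RD_spectrum_def shift_left_mult
    by auto
qed


section \<open>Spectra of the multiplication operators\<close>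

theorem theorem2p6:
  fixes a :: "'a::cstar_algebra_1"
  shows "(dsc_spectrum (left_mult (star a)) = cnj ` dsc_spectrum (right_mult a)
        \<and> dsc_spectrum (right_mult (star a)) = cnj ` dsc_spectrum (left_mult a))
    \<and> (RD_spectrum (left_mult (star a)) = cnj ` RD_spectrum (right_mult a)
        \<and> RD_spectrum (right_mult (star a)) = cnj ` RD_spectrum (left_mult a))
    \<and> (asc_spectrum (left_mult (star a)) = cnj ` asc_spectrum (right_mult a)
        \<and> asc_spectrum (right_mult (star a)) = cnj ` asc_spectrum (left_mult a))
    \<and> (LD_spectrum (left_mult (star a)) = cnj ` LD_spectrum (right_mult a)
        \<and> LD_spectrum (right_mult (star a)) = cnj ` LD_spectrum (left_mult a))
    \<and> (a = star a \<longrightarrow>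
        (\<forall>T \<in> {left_mult a, right_mult a, left_mult (star a), right_mult (star a)}.
           dsc_spectrum T \<subseteq> \<real> \<and> RD_spectrum T \<subseteq> \<real> \<and> asc_spectrum T \<subseteq> \<real> \<and> LD_spectrum T \<subseteq> \<real>)
        \<and> (asc_spectrum (left_mult a) = asc_spectrum (right_mult a)
            \<and> LD_spectrum (left_mult a) = LD_spectrum (right_mult a))
        \<and> (drazin_spectrum a = dsc_spectrum (left_mult a)
            \<and> dsc_spectrum (left_mult a) = dsc_spectrum (right_mult a)
            \<and> dsc_spectrum (right_mult a) = RD_spectrum (left_mult a)
            \<and> RD_spectrum (left_mult a) = RD_spectrum (right_mult a)))"
proof (intro conjI impI)
  assume "a = star a"
  then have herm: "star a = a"
    by (rule sym)
  note real = hermitian_spectra_real[OF herm]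
  show "\<forall>T \<in> {left_mult a, right_mult a, left_mult (star a), right_mult (star a)}.
      dsc_spectrum T \<subseteq> \<real> \<and> RD_spectrum T \<subseteq> \<real> \<and> asc_spectrum T \<subseteq> \<real> \<and> LD_spectrum T \<subseteq> \<real>"
    using real by (simp add: herm)
  have "cnj ` dsc_spectrum (right_mult a) = dsc_spectrum (right_mult a)"
    and "cnj ` RD_spectrum (right_mult a) = RD_spectrum (right_mult a)"
    and "cnj ` asc_spectrum (right_mult a) = asc_spectrum (right_mult a)"
    and "cnj ` LD_spectrum (right_mult a) = LD_spectrum (right_mult a)"
    by (rule cnj_image_real, rule real, simp)+
  with spectra_star(1,3,5,7)[of a, unfolded herm]
  show "asc_spectrum (left_mult a) = asc_spectrum (right_mult a)"
    and "LD_spectrum (left_mult a) = LD_spectrum (right_mult a)"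
    and left_right: "dsc_spectrum (left_mult a) = dsc_spectrum (right_mult a)"
    and "RD_spectrum (left_mult a) = RD_spectrum (right_mult a)"
    by metis+
  show "drazin_spectrum a = dsc_spectrum (left_mult a)"
    by (rule hermitian_drazin_spectrum(1)[OF herm])
  show "dsc_spectrum (right_mult a) = RD_spectrum (left_mult a)"
    using hermitian_drazin_spectrum(2)[OF herm] left_right by simp
qed (fact spectra_star)+

end
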